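(* Let $n\ge 1$ and $r\ge 1$ be integers. Let $I_{r,n}$ be the number of inversions of the permutation obtained after $r$ iterated random-to-top shuffles of an $n$-card deck, starting from the identity. Let $K_{r,n}$ be the number of occupied boxes when $r$ balls are thrown independently and uniformly at random into $n$ boxes, and let $R_1,\dots,R_n$ be independent random variables, independent of $K_{r,n}$, with $R_i$ discrete uniform on $\{0,1,2,\ldots,n-i\}$. Then $I_{r,n}$ is equal in distribution to $$\sum_{i=1}^{K_{r,n}}R_i.$$
   Context: A deck of $n$ cards labelled $1,\dots,n$ in some order is encoded by the permutation $\sigma$ of $[n]=\{1,\dots,n\}$ where $\sigma(i)$ is the card in position $i$ (position $1$ is the top). A random-to-top shuffle selects one of the $n$ cards uniformly at random (the top card may be selected) and moves it to the top, keeping the relative order of the other cards. Iterated random-to-top shuffles start from the deck in order $12\cdots n$ and perform the selections independently. An inversion of $\sigma$ is a pair $(i,j)$ with $1\le i<j\le n$ and $\sigma(i)>\sigma(j)$. *)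

theory Defs
  imports "HOL-Probability.Probability"
begin

text \<open>
  A deck is a permutation \<open>\<sigma>\<close> of \<open>{1..n}\<close> (the identity outside \<open>{1..n}\<close>); \<open>\<sigma> i\<close> is the card in
  position \<open>i\<close>, position \<open>1\<close> being the top.
\<close>

definition move_to_top :: "nat \<Rightarrow> (nat \<Rightarrow> nat) \<Rightarrow> nat \<Rightarrow> nat" where
  "move_to_top c \<sigma> i =
     (if i = 1 then c
      else if 2 \<le> i \<and> i \<le> inv \<sigma> c then \<sigma> (i - 1)
      else \<sigma> i)"

text \<open>\<open>c t\<close> is the card selected in the \<open>t\<close>-th shuffle, \<open>t = 1, 2, \<dots>\<close>; \<open>c 0\<close> is not used.\<close>

primrec deck_after :: "(nat \<Rightarrow> nat) \<Rightarrow> nat \<Rightarrow> nat \<Rightarrow> nat" where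
  "deck_after c 0 = id"
| "deck_after c (Suc t) = move_to_top (c (Suc t)) (deck_after c t)"

definition inversions :: "nat \<Rightarrow> (nat \<Rightarrow> nat) \<Rightarrow> (nat \<times> nat) set" where
  "inversions n \<sigma> = {(i, j). 1 \<le> i \<and> i < j \<and> j \<le> n \<and> \<sigma> i > \<sigma> j}"

text \<open>\<open>b t\<close> is the box into which the \<open>t\<close>-th ball falls.\<close>

definition occupied_boxes :: "(nat \<Rightarrow> nat) \<Rightarrow> nat \<Rightarrow> nat set" where
  "occupied_boxes b r = b ` {1..r}"

end

theory Submission
  imports Defs
begin

text \<open>
  After \<open>r\<close> shuffles the deck consists of the distinct selected cards, latest selection first, followed
  by the never selected cards in increasing order. Relabelling the cards permutes the selection
  sequences, so given that \<open>k\<close> distinct cards were selected, the top part is uniform on the ordered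
  \<open>k\<close>-samples of \<open>{1..n}\<close>. Extending a sample by a card of rank \<open>j\<close> among the \<open>n - i + 1\<close> remaining ones
  creates exactly \<open>j\<close> new inversions, hence the number of inversions is a sum of independent uniform
  variables on \<open>{0..n - i}\<close>, \<open>i = 1, \<dots>, k\<close>; and \<open>k\<close> is distributed as the number of occupied boxes.
\<close>

section \<open>Decks as lists and the shuffle acting on them\<close>

text \<open>List indices start at 0 and positions at 1. The identity outside \<open>{1..n}\<close>
  matches \<open>deck_after\<close>, so that decks can be compared as functions on all of
  \<open>nat\<close>.\<close>

definition list_deck :: "nat \<Rightarrow> nat list \<Rightarrow> nat \<Rightarrow> nat" where
  "list_deck n D i = (if 1 \<le> i \<and> i \<le> n then D ! (i - 1) else i)"

text \<open>Injectivity on all of \<open>nat\<close>, not only on \<open>{1..n}\<close>, is what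
  lets \<open>inv\<close> in \<open>move_to_top\<close> return the position of a card.\<close>

lemma inj_list_deck:
  assumes "distinct D" "set D = {1..n}"
  shows "inj (list_deck n D)"
proof -
  have len: "length D = n"
    using distinct_card[OF assms(1)] assms(2) by simp
  have rng: "1 \<le> D ! (i - 1)" "D ! (i - 1) \<le> n" if "1 \<le> i" "i \<le> n" for i
    using nth_mem[of "i - 1" D] that len assms(2) by auto
  have iff: "list_deck n D i \<in> {1..n} \<longleftrightarrow> i \<in> {1..n}" for i
    using rng[of i] by (simp add: list_deck_def)
  show ?thesis
  proof (rule injI)
    fix i j assume e: "list_deck n D i = list_deck n D j"
    show "i = j"
    proof (cases "(1 \<le> i \<and> i \<le> n) \<and> (1 \<le> j \<and> j \<le> n)")
      case True
      then have "D ! (i - 1) = D ! (j - 1)" using e by (simp add: list_deck_def)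
      then have "i - 1 = j - 1"
        using True len assms(1) by (subst (asm) nth_eq_iff_index_eq) auto
      then show ?thesis using True by auto
    next
      case False
      then have "i \<notin> {1..n}" "j \<notin> {1..n}" using e iff[of i] iff[of j] by auto
      then show ?thesis using e unfolding list_deck_def by (metis atLeastAtMost_iff)
    qed
  qed
qed

text \<open>With \<open>D = xs @ c # ys\<close>, the card \<open>c\<close> sits in position
  \<open>Suc (length xs)\<close>; the cards of \<open>xs\<close> slide down by one and those of
  \<open>ys\<close> stay.\<close>

lemma move_to_top_list_deck:
  assumes "distinct D" "set D = {1..n}" "c \<in> {1..n}"
  shows "move_to_top c (list_deck n D) = list_deck n (c # removeAll c D)"
proof -
  have len: "length D = n"
    using distinct_card[OF assms(1)] assms(2) by simp
  obtain xs ys where D: "D = xs @ c # ys" and "c \<notin> set xs"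
    using assms(2,3) split_list_first[of c D] by auto
  have "c \<notin> set ys" using D assms(1) by auto
  have rem: "removeAll c D = xs @ ys"
    using \<open>c \<notin> set xs\<close> \<open>c \<notin> set ys\<close> D by simp
  have "list_deck n D (Suc (length xs)) = c"
    using len D by (simp add: list_deck_def nth_append)
  then have inv: "inv (list_deck n D) c = Suc (length xs)"
    using inv_f_f[OF inj_list_deck[OF assms(1,2)]] by metis
  show ?thesis
  proof
    fix i
    have D_nth: "D ! m = (if m < length xs then xs ! m else (c # ys) ! (m - length xs))" for m
      by (simp add: D nth_append)
    have n: "n = Suc (length xs + length ys)" using len D by simp
    consider "i = 0" | "i = 1" | j where "i = Suc (Suc j)"
      by (metis One_nat_def not0_implies_Suc)
    then show "move_to_top c (list_deck n D) i = list_deck n (c # removeAll c D) i"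
    proof cases
      case 3
      \<comment> \<open>Beyond \<open>c\<close>, index \<open>Suc j\<close> of \<open>D\<close>
        skips over \<open>c\<close> and lands on index \<open>j - length xs\<close> of
        \<open>ys\<close>.\<close>
      have "j \<ge> length xs \<Longrightarrow> Suc j - length xs = Suc (j - length xs)" by simp
      then show ?thesis unfolding move_to_top_def inv rem unfolding list_deck_def D_nth n 3
        by (auto simp: nth_append)
    qed (use assms in \<open>auto simp: move_to_top_def list_deck_def\<close>)
  qed
qed

section \<open>The selected cards as the top part of the deck\<close>

text \<open>This is the recursion of the deck itself, started from the empty list instead of the
  full deck, so that only cards already selected appear.\<close>

primrec top_cards :: "(nat \<Rightarrow> nat) \<Rightarrow> nat \<Rightarrow> nat list" where
  "top_cards c 0 = []"
| "top_cards c (Suc t) = c (Suc t) # removeAll (c (Suc t)) (top_cards c t)"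

lemma distinct_top_cards: "distinct (top_cards c t)"
  by (induction t) (auto simp: distinct_removeAll)

lemma set_top_cards: "set (top_cards c t) = c ` {1..t}"
  by (induction t) (auto simp: atLeastAtMostSuc_conv)

lemma length_top_cards: "length (top_cards c t) = card (c ` {1..t})"
  by (metis distinct_card distinct_top_cards set_top_cards)

lemma top_cards_cong:
  "(\<And>s. s \<in> {1..t} \<Longrightarrow> c s = d s) \<Longrightarrow> top_cards c t = top_cards d t"
  by (induction t) auto

text \<open>An injective relabelling commutes with \<open>removeAll\<close>, hence with the whole
  recursion. This is the symmetry behind the uniformity of the top part.\<close>

lemma top_cards_comp:
  assumes "inj p"
  shows "top_cards (p \<circ> c) t = map p (top_cards c t)"
proof (induction t)
  case (Suc t)
  have "removeAll (p x) (map p xs) = map p (removeAll x xs)" for x xs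
    using assms by (induction xs) (auto simp: inj_eq)
  then show ?case using Suc by simp
qed simp

definition complete_deck :: "nat \<Rightarrow> nat list \<Rightarrow> nat list" where
  "complete_deck n L = L @ filter (\<lambda>x. x \<notin> set L) [1..<Suc n]"

lemma complete_deck_perm:
  assumes "distinct L" "set L \<subseteq> {1..n}"
  shows "distinct (complete_deck n L)" "set (complete_deck n L) = {1..n}"
  using assms by (auto simp: complete_deck_def)

text \<open>A selected card comes either from the top part or from the increasing remainder. In both
  cases the remainder stays increasing, so the new deck is again the completion of its top
  part.\<close>

lemma deck_after_eq:
  assumes "\<And>s. s \<in> {1..t} \<Longrightarrow> c s \<in> {1..n}"
  shows "deck_after c t = list_deck n (complete_deck n (top_cards c t))"
  using assms
proof (induction t)
  case 0
  then show ?case by (auto simp: list_deck_def complete_deck_def fun_eq_iff simp del: upt_Suc)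
next
  case (Suc t)
  let ?c = "c (Suc t)" and ?L = "top_cards c t"
  have sub: "set ?L \<subseteq> {1..n}" using Suc.prems by (auto simp: set_top_cards)
  have "deck_after c (Suc t) = move_to_top ?c (list_deck n (complete_deck n ?L))"
    using Suc by simp
  also have "\<dots> = list_deck n (?c # removeAll ?c (complete_deck n ?L))"
    using Suc.prems complete_deck_perm[OF distinct_top_cards sub]
    by (intro move_to_top_list_deck) auto
  also have "?c # removeAll ?c (complete_deck n ?L) = complete_deck n (top_cards c (Suc t))"
    by (auto simp: complete_deck_def removeAll_filter_not_eq intro!: filter_cong simp del: upt_Suc)
  finally show ?case .
qed

section \<open>Inversions of lists\<close>

text \<open>Counting smaller entries as a set gives the inversion number for distinct lists, and
  makes the contribution of \<open>x\<close> depend on the tail only through its set.\<close>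

primrec list_inv :: "nat list \<Rightarrow> nat" where
  "list_inv [] = 0"
| "list_inv (x # xs) = card {y \<in> set xs. y < x} + list_inv xs"

text \<open>Pairs with first index 0 correspond to the entries smaller than the head; all others
  come from the tail with both indices shifted by one.\<close>

lemma card_index_inversions:
  assumes "distinct D"
  shows "card {(i, j). i < j \<and> j < length D \<and> D ! i > D ! j} = list_inv D"
  using assms
proof (induction D)
  case (Cons x xs)
  let ?A = "{(i, j). i < j \<and> j < length xs \<and> xs ! i > xs ! j}"
  let ?J = "{j. j < length xs \<and> xs ! j < x}"
  have "finite ?A"
    by (rule finite_subset[of _ "{..<length xs} \<times> {..<length xs}"]) auto
  have "{(i, j). i < j \<and> j < length (x # xs) \<and> (x # xs) ! i > (x # xs) ! j} =
      (\<lambda>j. (0, Suc j)) ` ?J \<union> map_prod Suc Suc ` ?A" (is "?B = _")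
  proof (intro set_eqI)
    fix p :: "nat \<times> nat"
    obtain i j where p: "p = (i, j)" by force
    show "p \<in> ?B \<longleftrightarrow> p \<in> (\<lambda>j. (0, Suc j)) ` ?J \<union> map_prod Suc Suc ` ?A"
      unfolding p by (cases i; cases j) (auto simp: image_iff)
  qed
  moreover have "card ?J = card {y \<in> set xs. y < x}"
  proof (rule bij_betw_same_card[of "(!) xs"], rule bij_betw_imageI)
    show "inj_on ((!) xs) ?J"
      using Cons.prems by (auto intro!: inj_onI simp: nth_eq_iff_index_eq)
    show "(!) xs ` ?J = {y \<in> set xs. y < x}"
      by (auto simp: in_set_conv_nth)
  qed
  moreover have "card (map_prod Suc Suc ` ?A) = list_inv xs"
    using Cons by (subst card_image) (auto intro: inj_onI)
  moreover have "card ((\<lambda>j. (0::nat, Suc j)) ` ?J) = card ?J"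
    by (rule card_image) (auto intro: inj_onI)
  ultimately show ?case
    using \<open>finite ?A\<close> by (simp only: list_inv.simps, subst card_Un_disjoint) auto
qed simp

lemma card_inversions_list_deck:
  assumes "distinct D" "length D = n"
  shows "card (inversions n (list_deck n D)) = list_inv D"
proof -
  have "inversions n (list_deck n D) =
      map_prod Suc Suc ` {(i, j). i < j \<and> j < length D \<and> D ! i > D ! j}" (is "_ = _ ` ?A")
  proof (intro set_eqI)
    fix p :: "nat \<times> nat"
    obtain i j where p: "p = (i, j)" by force
    show "p \<in> inversions n (list_deck n D) \<longleftrightarrow> p \<in> map_prod Suc Suc ` ?A"
      unfolding p using assms(2)
      by (cases i; cases j) (auto simp: inversions_def list_deck_def image_iff)
  qed
  moreover have "card (map_prod Suc Suc ` ?A) = card ?A"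
    by (rule card_image) (auto intro: inj_onI)
  ultimately show ?thesis using card_index_inversions[OF assms(1)] by simp
qed

lemma list_inv_sorted: "sorted xs \<Longrightarrow> list_inv xs = 0"
  by (induction xs) (auto simp: leD)

text \<open>Each entry of the prefix \<open>L\<close> is compared only with the set of what follows
  it, and that set is the same on both sides.\<close>

lemma list_inv_append_cong:
  assumes "set a = set b" "list_inv a = list_inv b + d"
  shows "list_inv (L @ a) = list_inv (L @ b) + d"
  using assms by (induction L) auto

text \<open>Appending \<open>x\<close> to \<open>L\<close> pulls it to the front of the increasing
  remainder, past exactly the smaller cards outside \<open>L\<close>. Each card passed gives one new
  inversion, and the inversions involving \<open>L\<close> are unchanged.\<close>

lemma list_inv_complete_deck_snoc:
  assumes "x \<in> {1..n} - set L"
  shows "list_inv (complete_deck n (L @ [x])) =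
    list_inv (complete_deck n L) + card {y \<in> {1..n} - set L. y < x}"
proof -
  let ?f = "\<lambda>L. filter (\<lambda>x. x \<notin> set L) [1..<Suc n]"
  have z: "list_inv (?f L) = 0" for L
    by (intro list_inv_sorted sorted_wrt_filter) (simp del: upt_Suc)
  have "list_inv (L @ (x # ?f (L @ [x]))) =
      list_inv (L @ ?f L) + card {y \<in> {1..n} - set L. y < x}"
  proof (rule list_inv_append_cong)
    show "set (x # ?f (L @ [x])) = set (?f L)" using assms by auto
    have "{y \<in> set (?f (L @ [x])). y < x} = {y \<in> {1..n} - set L. y < x}" by auto
    then show "list_inv (x # ?f (L @ [x])) = list_inv (?f L) + card {y \<in> {1..n} - set L. y < x}"
      using z[of L] z[of "L @ [x]"] by (simp del: upt_Suc)
  qed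
  then show ?thesis by (simp add: complete_deck_def del: upt_Suc)
qed

section \<open>Ordered samples and their inversion codes\<close>

text \<open>The rank is strictly increasing on \<open>S\<close> and below \<open>card S\<close>, so
  counting gives surjectivity. It turns the choice of the next card into the choice of its number of
  new inversions.\<close>

lemma bij_betw_rank:
  fixes S :: "nat set"
  assumes "finite S"
  shows "bij_betw (\<lambda>x. card {y \<in> S. y < x}) S {..<card S}"
proof -
  have less: "card {y \<in> S. y < x} < card {y \<in> S. y < x'}" if "x \<in> S" "x < x'" for x x'
    using that assms by (intro psubset_card_mono) auto
  have inj: "inj_on (\<lambda>x. card {y \<in> S. y < x}) S"
  proof (rule inj_onI)
    fix x x' assume "x \<in> S" "x' \<in> S" "card {y \<in> S. y < x} = card {y \<in> S. y < x'}"
    then show "x = x'" using less[of x x'] less[of x' x] by (cases x x' rule: linorder_cases) auto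
  qed
  have "(\<lambda>x. card {y \<in> S. y < x}) ` S \<subseteq> {..<card S}"
  proof (rule image_subsetI)
    fix x assume "x \<in> S"
    then have "{y \<in> S. y < x} \<subset> S" by auto
    then show "card {y \<in> S. y < x} \<in> {..<card S}" using assms by (simp add: psubset_card_mono)
  qed
  then have "(\<lambda>x. card {y \<in> S. y < x}) ` S = {..<card S}"
    by (intro card_subset_eq) (auto simp: card_image[OF inj])
  with inj show ?thesis by (simp add: bij_betw_def)
qed

definition arrangements :: "nat \<Rightarrow> nat \<Rightarrow> nat list set" where
  "arrangements n k = {L. length L = k \<and> distinct L \<and> set L \<subseteq> {1..n}}"

lemma finite_arrangements: "finite (arrangements n k)"
  by (rule finite_subset[OF _ finite_lists_length_eq[of "{1..n}" k]]) (auto simp: arrangements_def)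

lemma sum_PiE_insert:
  fixes g :: "('i \<Rightarrow> 'v) \<Rightarrow> 'c :: comm_monoid_add"
  assumes "a \<notin> A"
  shows "(\<Sum>x\<in>PiE (insert a A) T. g x) = (\<Sum>v\<in>T a. \<Sum>x\<in>PiE A T. g (x(a := v)))"
  unfolding PiE_insert_eq
  by (subst sum.reindex[OF inj_combinator[OF assms]])
     (auto simp: sum.cartesian_product split_def intro!: sum.cong)

lemma arrangements_Suc:
  "arrangements n (Suc k) =
    (\<lambda>(L, x). L @ [x]) ` Sigma (arrangements n k) (\<lambda>L. {1..n} - set L)"
proof (intro set_eqI iffI)
  fix L assume L: "L \<in> arrangements n (Suc k)"
  obtain M x where e: "L = M @ [x]"
    using L by (cases L rule: rev_cases) (auto simp: arrangements_def)
  show "L \<in> (\<lambda>(L, x). L @ [x]) ` Sigma (arrangements n k) (\<lambda>L. {1..n} - set L)"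
    using L unfolding e
    by (intro image_eqI[of _ _ "(M, x)"]) (auto simp: arrangements_def)
qed (auto simp: arrangements_def)

text \<open>Recording the rank of each new card turns samples into codes whose entries add up to the
  inversion number. The freedom in \<open>g\<close> serves the induction, which uses the hypothesis
  for \<open>g (m + j)\<close> summed over \<open>j\<close>; later a constant and an indicator give
  the two cardinalities needed.\<close>

lemma sum_arrangements:
  fixes g :: "nat \<Rightarrow> 'c :: comm_monoid_add"
  assumes "k \<le> n"
  shows "(\<Sum>L\<in>arrangements n k. g (list_inv (complete_deck n L))) =
    (\<Sum>x\<in>PiE {1..k} (\<lambda>i. {0..n - i}). g (\<Sum>i=1..k. x i))"
  using assms
proof (induction k arbitrary: g)
  case 0
  have "arrangements n 0 = {[]}" by (auto simp: arrangements_def)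
  moreover have "list_inv (complete_deck n []) = 0"
    by (intro list_inv_sorted) (simp add: complete_deck_def del: upt_Suc)
  ultimately show ?case by simp
next
  case (Suc k)
  have inner: "(\<Sum>x\<in>{1..n} - set L. g (list_inv (complete_deck n (L @ [x])))) =
      (\<Sum>j\<in>{0..n - Suc k}. g (list_inv (complete_deck n L) + j))" if "L \<in> arrangements n k" for L
  proof -
    have "card ({1..n} - set L) = n - k"
      using that distinct_card[of L] by (subst card_Diff_subset) (auto simp: arrangements_def)
    \<comment> \<open>Subtraction is truncated, so this rests on \<open>Suc k <= n\<close>.\<close>
    moreover have "{0..n - Suc k} = {..<n - k}" using Suc.prems by auto
    ultimately show ?thesis
      using sum.reindex_bij_betw[OF bij_betw_rank[of "{1..n} - set L"],
          of "\<lambda>j. g (list_inv (complete_deck n L) + j)"]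
      by (simp add: list_inv_complete_deck_snoc)
  qed
  have "(\<Sum>L\<in>arrangements n (Suc k). g (list_inv (complete_deck n L))) =
      (\<Sum>L\<in>arrangements n k. \<Sum>x\<in>{1..n} - set L. g (list_inv (complete_deck n (L @ [x]))))"
    unfolding arrangements_Suc
    by (subst sum.reindex, force intro: inj_onI)
       (subst sum.Sigma, auto simp: finite_arrangements split_def)
  also have "\<dots> = (\<Sum>L\<in>arrangements n k. \<Sum>j\<in>{0..n - Suc k}. g (list_inv (complete_deck n L) + j))"
    by (intro sum.cong inner refl)
  also have "\<dots> = (\<Sum>x\<in>PiE {1..k} (\<lambda>i. {0..n - i}). \<Sum>j\<in>{0..n - Suc k}. g ((\<Sum>i=1..k. x i) + j))"
    using Suc.IH[of "\<lambda>m. \<Sum>j\<in>{0..n - Suc k}. g (m + j)"] Suc.prems by simp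
  also have "\<dots> = (\<Sum>j\<in>{0..n - Suc k}. \<Sum>x\<in>PiE {1..k} (\<lambda>i. {0..n - i}). g ((\<Sum>i=1..k. x i) + j))"
    by (rule sum.swap)
  also have "\<dots> = (\<Sum>x\<in>PiE (insert (Suc k) {1..k}) (\<lambda>i. {0..n - i}). g (\<Sum>i=1..Suc k. x i))"
    by (subst sum_PiE_insert) (auto intro!: sum.cong arg_cong[of _ _ g])
  finally show ?case by (simp add: atLeastAtMostSuc_conv)
qed

section \<open>Relabelling symmetry of selection sequences\<close>

text \<open>The map from \<open>L\<close> to \<open>L'\<close> entry by entry is extended by any
  bijection between the complements in \<open>{1..n}\<close>, which have equal size, and by the
  identity elsewhere to be injective on all of \<open>nat\<close>.\<close>

lemma permutation_of_arrangements:
  assumes "L \<in> arrangements n k" "L' \<in> arrangements n k"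
  obtains p where "inj p" "p ` {1..n} = {1..n}" "map p L = L'"
proof -
  have len: "length L = k" "length L' = k" and d: "distinct L" "distinct L'"
    and sub: "set L \<subseteq> {1..n}" "set L' \<subseteq> {1..n}"
    using assms by (auto simp: arrangements_def)
  \<comment> \<open>The description picks the index at which \<open>x\<close> occurs in
    \<open>L\<close>; it is unique because \<open>L\<close> is distinct.\<close>
  define q where "q x = L' ! (THE i. i < k \<and> L ! i = x)" for x
  have q: "q (L ! i) = L' ! i" if "i < k" for i
  proof -
    have "(THE j. j < k \<and> L ! j = L ! i) = i"
      using that len d(1) by (intro the_equality) (auto simp: nth_eq_iff_index_eq)
    then show ?thesis by (simp add: q_def)
  qed
  have mq: "map q L = L'" using len q by (intro nth_equalityI) auto
  then have "bij_betw q (set L) (set L')"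
    using d by (metis bij_betw_def distinct_map image_set)
  moreover have "card ({1..n} - set L) = card ({1..n} - set L')"
    using len sub d by (simp add: card_Diff_subset distinct_card)
  then obtain s where "bij_betw s ({1..n} - set L) ({1..n} - set L')"
    using finite_same_card_bij[of "{1..n} - set L" "{1..n} - set L'"] by auto
  ultimately have "bij_betw (\<lambda>x. if x \<in> set L then q x else s x)
      (set L \<union> ({1..n} - set L)) (set L' \<union> ({1..n} - set L'))"
    by (intro bij_betw_disjoint_Un) auto
  then have b: "bij_betw (\<lambda>x. if x \<in> set L then q x else s x) {1..n} {1..n}"
    using sub by (simp add: Un_absorb1)
  define p where "p x = (if x \<in> {1..n} then if x \<in> set L then q x else s x else x)" for x
  have p1: "bij_betw p {1..n} {1..n}"
    using b by (subst bij_betw_cong[of _ p]) (auto simp: p_def)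
  moreover have "bij_betw p (- {1..n}) (- {1..n})"
    by (subst bij_betw_cong[of _ _ id]) (auto simp: p_def)
  ultimately have "bij_betw p ({1..n} \<union> - {1..n}) ({1..n} \<union> - {1..n})"
    by (intro bij_betw_combine) auto
  then have "inj p" by (simp add: bij_betw_def)
  moreover have "map p L = L'"
    using mq sub(1) by (auto simp: p_def subset_iff)
  ultimately show ?thesis using p1 that by (auto simp: bij_betw_def)
qed

text \<open>Composition with a relabelling that carries \<open>L\<close> to \<open>L'\<close>
  injects the first set into the second; exchanging \<open>L\<close> and \<open>L'\<close> gives the
  other inequality.\<close>

lemma card_top_cards_eq:
  assumes "L \<in> arrangements n k" "L' \<in> arrangements n k"
  shows "card {c \<in> PiE {1..r} (\<lambda>_. {1..n}). top_cards c r = L} =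
    card {c \<in> PiE {1..r} (\<lambda>_. {1..n}). top_cards c r = L'}"
proof -
  have le: "card {c \<in> PiE {1..r} (\<lambda>_. {1..n}). top_cards c r = L} \<le>
      card {c \<in> PiE {1..r} (\<lambda>_. {1..n}). top_cards c r = L'}" (is "card ?A \<le> card ?B")
    if L: "L \<in> arrangements n k" and L': "L' \<in> arrangements n k" for L L'
  proof -
    obtain p where p: "inj p" "p ` {1..n} = {1..n}" "map p L = L'"
      using permutation_of_arrangements[OF L L'] .
    \<comment> \<open>The restriction resets the values outside \<open>{1..r}\<close> to
      \<open>undefined\<close>, as membership in \<open>PiE\<close> demands.\<close>
    let ?f = "\<lambda>c. restrict (p \<circ> c) {1..r}"
    have "inj_on ?f ?A"
    proof (rule inj_onI)
      fix c d assume *: "c \<in> ?A" "d \<in> ?A" "?f c = ?f d"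
      have "c i = d i" if "i \<in> {1..r}" for i
        using fun_cong[OF *(3), of i] that p(1) by (simp add: inj_eq)
      then show "c = d" using *(1,2) by (intro PiE_ext[of _ "{1..r}" "\<lambda>_. {1..n}"]) auto
    qed
    moreover have "?f ` ?A \<subseteq> ?B"
    proof (rule image_subsetI)
      fix c assume c: "c \<in> ?A"
      have "?f c \<in> PiE {1..r} (\<lambda>_. {1..n})"
        using c p(2) by (auto simp: PiE_iff)
      moreover have "top_cards (?f c) r = top_cards (p \<circ> c) r" by (rule top_cards_cong) auto
      ultimately show "?f c \<in> ?B" using top_cards_comp[OF p(1)] p(3) c by simp
    qed
    moreover have "finite ?B" by (simp add: finite_PiE)
    ultimately show ?thesis by (rule card_inj_on_le)
  qed
  show ?thesis using le[OF assms] le[OF assms(2,1)] by simp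
qed

lemma card_fibres:
  assumes "finite W" "finite T"
  shows "card {c \<in> W. f c \<in> T} = (\<Sum>y\<in>T. card {c \<in> W. f c = y})"
proof -
  have "{c \<in> W. f c \<in> T} = (\<Union>y\<in>T. {c \<in> W. f c = y})" by auto
  then show ?thesis using assms by (simp only:, subst card_UN_disjoint) auto
qed

lemma card_eq_sum_if: "finite A \<Longrightarrow> card {x \<in> A. P x} = (\<Sum>x\<in>A. if P x then 1 else 0)"
  using sum.inter_filter[of A "\<lambda>_. 1::nat" P] by simp

text \<open>Given \<open>k\<close> distinct selected cards, the inversion number is distributed as
  the sum of a uniform code. The cross-multiplied form stays within \<open>nat\<close> and also
  covers a \<open>k\<close> that no sequence attains.\<close>

lemma card_top_cards_inversions:
  fixes n r k m :: nat
  defines "W \<equiv> PiE {1..r} (\<lambda>_. {1..n})" and "codes \<equiv> PiE {1..k} (\<lambda>i. {0..n - i})"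
  assumes "k \<le> n"
  shows "card {c \<in> W. card (c ` {1..r}) = k \<and> list_inv (complete_deck n (top_cards c r)) = m}
      * card codes
    = card {c \<in> W. card (c ` {1..r}) = k} * card {x \<in> codes. (\<Sum>i=1..k. x i) = m}"
proof -
  have fin: "finite W" "finite codes" by (auto simp: W_def codes_def finite_PiE)
  \<comment> \<open>The number of selection sequences behind one sample, read off at an arbitrary
    reference sample; by symmetry it is the same for all.\<close>
  define u where "u = card {c \<in> W. top_cards c r = [1..<Suc k]}"
  have "[1..<Suc k] \<in> arrangements n k" using assms(3) by (auto simp: arrangements_def)
  then have u: "card {c \<in> W. top_cards c r = L} = u" if "L \<in> arrangements n k" for L
    using card_top_cards_eq[OF that] unfolding W_def u_def by blast
  let ?A = "{L \<in> arrangements n k. list_inv (complete_deck n L) = m}"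
  have top: "top_cards c r \<in> arrangements n k \<longleftrightarrow> card (c ` {1..r}) = k" if "c \<in> W" for c
    using that by (auto simp: W_def arrangements_def distinct_top_cards set_top_cards length_top_cards)
  have count: "card {c \<in> W. top_cards c r \<in> T} = card T * u" if "T \<subseteq> arrangements n k" for T
    using that finite_arrangements fin u
    by (subst card_fibres) (auto intro: finite_subset simp: subset_iff)
  have "{c \<in> W. card (c ` {1..r}) = k \<and> list_inv (complete_deck n (top_cards c r)) = m} =
      {c \<in> W. top_cards c r \<in> ?A}"
    using top by auto
  moreover have "{c \<in> W. card (c ` {1..r}) = k} = {c \<in> W. top_cards c r \<in> arrangements n k}"
    using top by auto
  moreover have "card (arrangements n k) = card codes"
    using sum_arrangements[OF assms(3), of "\<lambda>_. 1::nat"] by (simp add: codes_def)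
  moreover have "card ?A = card {x \<in> codes. (\<Sum>i=1..k. x i) = m}"
    using sum_arrangements[OF assms(3), of "\<lambda>s. if s = m then 1 else 0::nat"] fin
    by (simp add: codes_def card_eq_sum_if finite_arrangements)
  ultimately show ?thesis using count[of ?A] count[of "arrangements n k"] by auto
qed

section \<open>Joint laws of independent finitely valued variables\<close>

text \<open>The event splits into the finitely many point events \<open>E x\<close>, whose
  probabilities factor. Only singletons of \<open>S i\<close> have to be measurable, so
  \<open>M' i\<close> may live on a larger space than \<open>S i\<close>, as it does for
  \<open>K\<close> below.\<close>

lemma (in prob_space) indep_vars_finite_joint:
  fixes X :: "'i \<Rightarrow> 'a \<Rightarrow> 'v"
  assumes indep: "indep_vars M' X J" and J: "finite J" "J \<noteq> {}"
    and S: "\<And>i. i \<in> J \<Longrightarrow> finite (S i)"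
    and sing: "\<And>i v. i \<in> J \<Longrightarrow> v \<in> S i \<Longrightarrow> {v} \<in> sets (M' i)"
    and X: "\<And>i \<omega>. i \<in> J \<Longrightarrow> \<omega> \<in> space M \<Longrightarrow> X i \<omega> \<in> S i"
  shows "{\<omega> \<in> space M. Q (restrict (\<lambda>i. X i \<omega>) J)} \<in> events" (is ?A)
    and "prob {\<omega> \<in> space M. Q (restrict (\<lambda>i. X i \<omega>) J)} =
      (\<Sum>x\<in>{x \<in> PiE J S. Q x}. \<Prod>i\<in>J. prob {\<omega> \<in> space M. X i \<omega> = x i})" (is ?B)
proof -
  let ?T = "{x \<in> PiE J S. Q x}"
  define E where "E x = (\<Inter>i\<in>J. X i -` {x i} \<inter> space M)" for x
  have mem: "\<omega> \<in> E x \<longleftrightarrow> \<omega> \<in> space M \<and> restrict (\<lambda>i. X i \<omega>) J = x"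
    if "x \<in> PiE J S" for x \<omega>
  proof
    assume "\<omega> \<in> E x"
    then have "\<omega> \<in> space M" "\<And>i. i \<in> J \<Longrightarrow> X i \<omega> = x i" using J(2) by (auto simp: E_def)
    moreover have "restrict (\<lambda>i. X i \<omega>) J \<in> PiE J S" using X \<open>\<omega> \<in> space M\<close> by auto
    ultimately show "\<omega> \<in> space M \<and> restrict (\<lambda>i. X i \<omega>) J = x"
      using that by (auto intro: PiE_ext)
  qed (auto simp: E_def)
  have union: "{\<omega> \<in> space M. Q (restrict (\<lambda>i. X i \<omega>) J)} = (\<Union>x\<in>?T. E x)"
    using mem X by auto
  have fin: "finite ?T" using J S by (simp add: finite_PiE)
  have E: "E x \<in> events" if "x \<in> PiE J S" for x
    unfolding E_def
  proof (rule sets.finite_INT[OF J])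
    fix i assume "i \<in> J"
    moreover from this have "x i \<in> S i" using that by auto
    ultimately show "X i -` {x i} \<inter> space M \<in> events"
      using sing indep by (auto simp: indep_vars_def intro!: measurable_sets)
  qed
  show ?A unfolding union using fin E by auto
  have "prob (E x) = (\<Prod>i\<in>J. prob {\<omega> \<in> space M. X i \<omega> = x i})" if "x \<in> ?T" for x
  proof -
    have "prob (E x) = (\<Prod>i\<in>J. prob (X i -` {x i} \<inter> space M))"
      unfolding E_def using that sing by (intro indep_varsD[OF indep J(2,1)]) auto
    also have "\<dots> = (\<Prod>i\<in>J. prob {\<omega> \<in> space M. X i \<omega> = x i})"
      by (intro prod.cong arg_cong[of _ _ prob]) auto
    finally show ?thesis .
  qed
  moreover have "prob (\<Union>x\<in>?T. E x) = (\<Sum>x\<in>?T. prob (E x))"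
    using fin E mem by (intro finite_measure_finite_Union) (auto simp: disjoint_family_on_def)
  ultimately show ?B unfolding union by simp
qed

lemma (in prob_space) prob_eq_if_uniform:
  assumes "X \<in> measurable M (count_space S)" "finite S" "v \<in> S"
    and "distr M (count_space S) X = uniform_count_measure S"
  shows "prob {\<omega> \<in> space M. X \<omega> = v} = 1 / card S"
proof -
  have "measure (distr M (count_space S) X) {v} = prob (X -` {v} \<inter> space M)"
    using assms by (intro measure_distr) auto
  also have "X -` {v} \<inter> space M = {\<omega> \<in> space M. X \<omega> = v}" by auto
  finally show ?thesis using assms by (simp add: measure_uniform_count_measure)
qed

text \<open>All points of the product set have the same mass, the product of the
  \<open>1 / card (S i)\<close>, so probabilities are proportions. This handles both the selections
  and the balls.\<close>

lemma (in prob_space) indep_uniform_joint: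
  fixes X :: "'i \<Rightarrow> 'a \<Rightarrow> 'v"
  assumes indep: "indep_vars (\<lambda>i. count_space (S i)) X J" and J: "finite J" "J \<noteq> {}"
    and S: "\<And>i. i \<in> J \<Longrightarrow> finite (S i)"
    and unif: "\<And>i. i \<in> J \<Longrightarrow> distr M (count_space (S i)) (X i) = uniform_count_measure (S i)"
  shows "{\<omega> \<in> space M. Q (restrict (\<lambda>i. X i \<omega>) J)} \<in> events"
    and "prob {\<omega> \<in> space M. Q (restrict (\<lambda>i. X i \<omega>) J)} =
      card {x \<in> PiE J S. Q x} / card (PiE J S)"
proof -
  have meas: "X i \<in> measurable M (count_space (S i))" if "i \<in> J" for i
    using indep that by (auto simp: indep_vars_def)
  have X: "X i \<omega> \<in> S i" if "i \<in> J" "\<omega> \<in> space M" for i \<omega>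
    using measurable_space[OF meas that(2)] that(1) by simp
  show "{\<omega> \<in> space M. Q (restrict (\<lambda>i. X i \<omega>) J)} \<in> events"
    by (rule indep_vars_finite_joint[OF indep J S]) (auto simp: X)
  have "prob {\<omega> \<in> space M. Q (restrict (\<lambda>i. X i \<omega>) J)} =
      (\<Sum>x\<in>{x \<in> PiE J S. Q x}. \<Prod>i\<in>J. prob {\<omega> \<in> space M. X i \<omega> = x i})"
    by (rule indep_vars_finite_joint[OF indep J S]) (auto simp: X)
  also have "\<dots> = (\<Sum>x\<in>{x \<in> PiE J S. Q x}. \<Prod>i\<in>J. 1 / card (S i))"
    by (intro sum.cong prod.cong refl prob_eq_if_uniform meas S unif) auto
  also have "\<dots> = card {x \<in> PiE J S. Q x} / card (PiE J S)"
    by (simp add: card_PiE J prod_dividef)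
  finally show "prob {\<omega> \<in> space M. Q (restrict (\<lambda>i. X i \<omega>) J)} =
      card {x \<in> PiE J S. Q x} / card (PiE J S)" .
qed

section \<open>Equality of the two distributions\<close>

theorem theorem4p3:
  fixes n r :: nat
    and M :: "'a measure" and C :: "nat \<Rightarrow> 'a \<Rightarrow> nat" and I :: "'a \<Rightarrow> nat"
    and N :: "'b measure" and B :: "nat \<Rightarrow> 'b \<Rightarrow> nat" and K :: "'b \<Rightarrow> nat"
    and R :: "nat \<Rightarrow> 'b \<Rightarrow> nat"
  assumes "n \<ge> 1" and "r \<ge> 1"
    and "prob_space M" and "prob_space N"
    and C_indep: "prob_space.indep_vars M (\<lambda>_. count_space {1..n}) C {1..r}"
    and C_unif: "\<And>t. t \<in> {1..r} \<Longrightarrow>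
      distr M (count_space {1..n}) (C t) = uniform_count_measure {1..n}"
    and I: "\<And>\<omega>. I \<omega> = card (inversions n (deck_after (\<lambda>t. C t \<omega>) r))"
    and B_indep: "prob_space.indep_vars N (\<lambda>_. count_space {1..n}) B {1..r}"
    and B_unif: "\<And>t. t \<in> {1..r} \<Longrightarrow>
      distr N (count_space {1..n}) (B t) = uniform_count_measure {1..n}"
    and K: "\<And>\<omega>. K \<omega> = card (occupied_boxes (\<lambda>t. B t \<omega>) r)"
    and R_unif: "\<And>i. i \<in> {1..n} \<Longrightarrow>
      distr N (count_space {0..n - i}) (R i) = uniform_count_measure {0..n - i}"
    and KR_indep: "prob_space.indep_vars N
      (\<lambda>i. if i = 0 then count_space UNIV else count_space {0..n - i})
      (\<lambda>i. if i = 0 then K else R i) {0..n}"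
  shows "distr M (count_space UNIV) I =
    distr N (count_space UNIV) (\<lambda>\<omega>. \<Sum>i = 1..K \<omega>. R i \<omega>)"
proof -
  interpret M: prob_space M by fact
  interpret N: prob_space N by fact
  \<comment> \<open>\<open>W\<close> serves both as the set of selection sequences and as the set of
    ball placements, so \<open>occ\<close> counts distinct cards as well as occupied boxes.\<close>
  define W where "W = PiE {1..r} (\<lambda>_. {1..n})"
  define occ where "occ c = card (c ` {1..r})" for c :: "nat \<Rightarrow> nat"
  define invs where "invs c = list_inv (complete_deck n (top_cards c r))" for c
  define codes where "codes k = PiE {1..k} (\<lambda>i. {0..n - i})" for k
  define Z where "Z \<omega> = (\<Sum>i = 1..K \<omega>. R i \<omega>)" for \<omega>
  \<comment> \<open>The joint laws are stated for a nonempty index set; this is where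
    \<open>r >= 1\<close> enters.\<close>
  have ne: "{1..r} \<noteq> {}" using assms(2) by auto
  have W: "finite W" "card W > 0" using assms(1) by (auto simp: W_def finite_PiE card_PiE)
  have codes: "card (codes k) > 0" for k by (auto simp: codes_def card_PiE)
  have occ_le: "occ c \<le> n" if "c \<in> W" for c
    using card_mono[of "{1..n}" "c ` {1..r}"] that by (auto simp: W_def occ_def)

  have C_mem: "C t \<omega> \<in> {1..n}" if "t \<in> {1..r}" "\<omega> \<in> space M" for t \<omega>
    using measurable_space[of "C t" M "count_space {1..n}" \<omega>] C_indep that
    unfolding M.indep_vars_def by auto
  have B_mem: "B t \<omega> \<in> {1..n}" if "t \<in> {1..r}" "\<omega> \<in> space N" for t \<omega>
    using measurable_space[of "B t" N "count_space {1..n}" \<omega>] B_indep that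
    unfolding N.indep_vars_def by auto
  have R_meas: "R i \<in> measurable N (count_space {0..n - i})" if "i \<in> {1..n}" for i
    using KR_indep that by (auto simp: N.indep_vars_def dest!: bspec[of _ _ i])
  have R_mem: "R i \<omega> \<in> {0..n - i}" if "i \<in> {1..n}" "\<omega> \<in> space N" for i \<omega>
    using measurable_space[OF R_meas that(2)] that(1) by simp

  have I_eq: "I \<omega> = invs (restrict (\<lambda>t. C t \<omega>) {1..r})" if "\<omega> \<in> space M" for \<omega>
  proof -
    have mem: "C s \<omega> \<in> {1..n}" if "s \<in> {1..r}" for s using C_mem that \<open>\<omega> \<in> space M\<close> by blast
    let ?L = "top_cards (\<lambda>t. C t \<omega>) r"
    have L: "distinct ?L" "set ?L \<subseteq> {1..n}"
      using mem by (auto simp: distinct_top_cards set_top_cards)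
    note D = complete_deck_perm[OF L]
    have "I \<omega> = card (inversions n (list_deck n (complete_deck n ?L)))"
      unfolding I using deck_after_eq[of r "\<lambda>t. C t \<omega>" n] mem by metis
    also have "\<dots> = list_inv (complete_deck n ?L)"
      using D distinct_card[OF D(1)] by (intro card_inversions_list_deck) auto
    also have "?L = top_cards (restrict (\<lambda>t. C t \<omega>) {1..r}) r" by (rule top_cards_cong) auto
    finally show ?thesis by (simp add: invs_def)
  qed
  have K_eq: "K \<omega> = occ (restrict (\<lambda>t. B t \<omega>) {1..r})" for \<omega>
    by (simp add: K occupied_boxes_def occ_def)
  have K_le: "K \<omega> \<le> n" if "\<omega> \<in> space N" for \<omega>
    unfolding K_eq using B_mem that by (intro occ_le) (auto simp: W_def)

  have set_I: "{\<omega> \<in> space M. I \<omega> = m} =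
      {\<omega> \<in> space M. invs (restrict (\<lambda>t. C t \<omega>) {1..r}) = m}" for m
    using I_eq by auto
  have I_events: "{\<omega> \<in> space M. I \<omega> = m} \<in> M.events" for m
    unfolding set_I by (rule M.indep_uniform_joint[OF C_indep _ ne _ C_unif]) auto
  have prob_I: "M.prob {\<omega> \<in> space M. I \<omega> = m} = card {c \<in> W. invs c = m} / card W" for m
    unfolding set_I W_def by (rule M.indep_uniform_joint[OF C_indep _ ne _ C_unif]) auto
  have prob_K: "N.prob {\<omega> \<in> space N. K \<omega> = k} = card {c \<in> W. occ c = k} / card W" for k
    unfolding K_eq W_def by (rule N.indep_uniform_joint[OF B_indep _ ne _ B_unif]) auto

  \<comment> \<open>On \<open>K = k\<close> the random upper limit of the sum is fixed, and the
    event concerns only the independent variables \<open>K\<close>, \<open>R 1\<close>, ...,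
    \<open>R k\<close>.\<close>
  have KR: "{\<omega> \<in> space N. K \<omega> = k \<and> Z \<omega> = m} \<in> N.events" (is "?E \<in> _")
    "N.prob {\<omega> \<in> space N. K \<omega> = k \<and> Z \<omega> = m} = N.prob {\<omega> \<in> space N. K \<omega> = k} *
        (card {x \<in> codes k. (\<Sum>i=1..k. x i) = m} / card (codes k))" if "k \<le> n" for k m
  proof -
    define X where "X i = (if i = 0 then K else R i)" for i
    \<comment> \<open>Index 0 carries \<open>K\<close>, whose measurable space is all of
      \<open>nat\<close>; the bound \<open>K_le\<close> supplies the finite value set
      \<open>{0..n}\<close>.\<close>
    define S where "S i = (if i = 0 then {0..n} else {0..n - i})" for i
    define Q where "Q x \<longleftrightarrow> x 0 = k \<and> (\<Sum>i=1..k. x i) = m" for x :: "nat \<Rightarrow> nat"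
    have indep: "N.indep_vars (\<lambda>i. if i = 0 then count_space UNIV else count_space {0..n - i}) X {0..k}"
      unfolding X_def using that by (intro N.indep_vars_subset[OF KR_indep]) auto
    have X: "X i \<omega> \<in> S i" if "i \<in> {0..k}" "\<omega> \<in> space N" for i \<omega>
      using that \<open>k \<le> n\<close> K_le[of \<omega>] R_mem[of i \<omega>] by (auto simp: X_def S_def)
    have set: "?E = {\<omega> \<in> space N. Q (restrict (\<lambda>i. X i \<omega>) {0..k})}"
    proof -
      have "(\<Sum>i=1..k. restrict (\<lambda>i. X i \<omega>) {0..k} i) = (\<Sum>i=1..k. R i \<omega>)" for \<omega>
        by (intro sum.cong) (auto simp: X_def)
      then show ?thesis by (auto simp: Q_def Z_def X_def)
    qed
    show "?E \<in> N.events"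
      unfolding set by (rule N.indep_vars_finite_joint[OF indep, of S]) (use X in \<open>auto simp: S_def\<close>)
    have prod: "(\<Prod>i\<in>{0..k}. N.prob {\<omega> \<in> space N. X i \<omega> = x i}) =
        N.prob {\<omega> \<in> space N. K \<omega> = k} * (1 / card (codes k))"
      if x: "x \<in> {x \<in> PiE {0..k} S. Q x}" for x
    proof -
      have "N.prob {\<omega> \<in> space N. X i \<omega> = x i} = 1 / card {0..n - i}" if i: "i \<in> {1..k}" for i
      proof -
        have "x i \<in> S i" using x i by auto
        then have "N.prob {\<omega> \<in> space N. R i \<omega> = x i} = 1 / card {0..n - i}"
          using i \<open>k \<le> n\<close> by (intro N.prob_eq_if_uniform R_meas R_unif) (auto simp: S_def)
        then show ?thesis using i by (simp add: X_def)
      qed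
      then have "(\<Prod>i\<in>{1..k}. N.prob {\<omega> \<in> space N. X i \<omega> = x i}) = 1 / card (codes k)"
        by (simp add: codes_def card_PiE prod_dividef)
      moreover have "{0..k} = insert 0 {1..k}" by auto
      moreover have "x 0 = k" using x by (simp add: Q_def)
      ultimately show ?thesis by (simp add: X_def)
    qed
    \<comment> \<open>\<open>Q\<close> forces coordinate 0 to be \<open>k\<close>, so joint outcomes
      are codes with this one entry added.\<close>
    have "bij_betw (\<lambda>x. x(0 := k)) {x \<in> codes k. (\<Sum>i=1..k. x i) = m} {x \<in> PiE {0..k} S. Q x}"
    proof (rule bij_betw_byWitness[where f' = "\<lambda>x. restrict x {1..k}"])
      show "\<forall>x\<in>{x \<in> codes k. (\<Sum>i=1..k. x i) = m}. restrict (x(0 := k)) {1..k} = x"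
        by (auto simp: codes_def fun_eq_iff PiE_iff extensional_def)
      show "\<forall>x\<in>{x \<in> PiE {0..k} S. Q x}. (restrict x {1..k})(0 := k) = x"
        by (auto simp: Q_def fun_eq_iff PiE_iff extensional_def)
      have "(\<Sum>i=1..k. (x(0 := k)) i) = (\<Sum>i=1..k. x i)" for x :: "nat \<Rightarrow> nat"
        by (intro sum.cong) auto
      then show "(\<lambda>x. x(0 := k)) ` {x \<in> codes k. (\<Sum>i=1..k. x i) = m} \<subseteq> {x \<in> PiE {0..k} S. Q x}"
        using that by (auto simp: codes_def Q_def S_def PiE_iff extensional_def Suc_le_eq)
      show "(\<lambda>x. restrict x {1..k}) ` {x \<in> PiE {0..k} S. Q x} \<subseteq> {x \<in> codes k. (\<Sum>i=1..k. x i) = m}"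
        by (auto simp: codes_def Q_def S_def PiE_iff)
    qed
    then have "card {x \<in> PiE {0..k} S. Q x} = card {x \<in> codes k. (\<Sum>i=1..k. x i) = m}"
      by (simp add: bij_betw_same_card)
    moreover have "N.prob ?E = (\<Sum>x\<in>{x \<in> PiE {0..k} S. Q x}.
        \<Prod>i\<in>{0..k}. N.prob {\<omega> \<in> space N. X i \<omega> = x i})"
      unfolding set by (rule N.indep_vars_finite_joint[OF indep, of S]) (use X in \<open>auto simp: S_def\<close>)
    moreover have "\<dots> = (\<Sum>x\<in>{x \<in> PiE {0..k} S. Q x}.
        N.prob {\<omega> \<in> space N. K \<omega> = k} * (1 / card (codes k)))"
      by (intro sum.cong refl prod)
    ultimately show "N.prob ?E = N.prob {\<omega> \<in> space N. K \<omega> = k} *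
        (card {x \<in> codes k. (\<Sum>i=1..k. x i) = m} / card (codes k))"
      by simp
  qed

  have set_Z: "{\<omega> \<in> space N. Z \<omega> = m} = (\<Union>k\<in>{0..n}. {\<omega> \<in> space N. K \<omega> = k \<and> Z \<omega> = m})" for m
    using K_le by auto
  have Z_events: "{\<omega> \<in> space N. Z \<omega> = m} \<in> N.events" for m
    unfolding set_Z using KR(1) by (intro sets.finite_UN) auto

  have prob_eq: "M.prob {\<omega> \<in> space M. I \<omega> = m} = N.prob {\<omega> \<in> space N. Z \<omega> = m}" for m
  proof -
    \<comment> \<open>Selection sequences are split by their number of distinct cards, to be matched
      with the split of \<open>Z\<close> by the value of \<open>K\<close>.\<close>
    have "{c \<in> W. invs c = m} = {c \<in> {c \<in> W. invs c = m}. occ c \<in> {0..n}}"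
      using occ_le by auto
    then have "card {c \<in> W. invs c = m} = (\<Sum>k\<in>{0..n}. card {c \<in> {c \<in> W. invs c = m}. occ c = k})"
      using card_fibres[of "{c \<in> W. invs c = m}" "{0..n}" occ] W(1) by simp
    then have "M.prob {\<omega> \<in> space M. I \<omega> = m} =
        (\<Sum>k\<in>{0..n}. card {c \<in> {c \<in> W. invs c = m}. occ c = k} / card W)"
      by (simp add: prob_I sum_divide_distrib)
    also have "\<dots> = (\<Sum>k\<in>{0..n}. N.prob {\<omega> \<in> space N. K \<omega> = k \<and> Z \<omega> = m})"
    proof (rule sum.cong[OF refl])
      fix k assume "k \<in> {0..n}"
      then have k: "k \<le> n" by simp
      have "{c \<in> {c \<in> W. invs c = m}. occ c = k} = {c \<in> W. occ c = k \<and> invs c = m}" by auto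
      then have "card {c \<in> {c \<in> W. invs c = m}. occ c = k} * card (codes k) =
          card {c \<in> W. occ c = k} * card {x \<in> codes k. (\<Sum>i=1..k. x i) = m}"
        using card_top_cards_inversions[OF k, of r m] by (simp add: W_def codes_def occ_def invs_def)
      then have "real (card {c \<in> {c \<in> W. invs c = m}. occ c = k}) * card (codes k) =
          real (card {c \<in> W. occ c = k}) * card {x \<in> codes k. (\<Sum>i=1..k. x i) = m}"
        by (simp only: of_nat_mult[symmetric])
      then show "card {c \<in> {c \<in> W. invs c = m}. occ c = k} / card W =
          N.prob {\<omega> \<in> space N. K \<omega> = k \<and> Z \<omega> = m}"
        \<comment> \<open>Both \<open>card W\<close> and \<open>card (codes k)\<close> are positive,
          so the cross-multiplied identity can be divided by them.\<close>
        using codes[of k] W(2) unfolding KR(2)[OF k] prob_K by (simp add: divide_simps)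
    qed
    also have "\<dots> = N.prob {\<omega> \<in> space N. Z \<omega> = m}"
      unfolding set_Z using KR(1)
      by (intro N.finite_measure_finite_Union[symmetric]) (auto simp: disjoint_family_on_def)
    finally show ?thesis .
  qed

  have I_meas: "I \<in> measurable M (count_space UNIV)"
    using I_events by (subst measurable_count_space_eq2_countable) (auto simp: vimage_def Int_def conj_commute)
  have Z_meas: "Z \<in> measurable N (count_space UNIV)"
    using Z_events by (subst measurable_count_space_eq2_countable) (auto simp: vimage_def Int_def conj_commute)
  have "distr M (count_space UNIV) I = distr N (count_space UNIV) Z"
  proof (rule measure_eqI_countable[of _ UNIV])
    fix m :: nat
    have "I -` {m} \<inter> space M = {\<omega> \<in> space M. I \<omega> = m}" "Z -` {m} \<inter> space N = {\<omega> \<in> space N. Z \<omega> = m}"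
      by auto
    then show "emeasure (distr M (count_space UNIV) I) {m} = emeasure (distr N (count_space UNIV) Z) {m}"
      using I_meas Z_meas prob_eq[of m]
      by (simp add: emeasure_distr M.emeasure_eq_measure N.emeasure_eq_measure)
  qed auto
  then show ?thesis by (simp add: Z_def[abs_def])
qed

end
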